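(* For every real number $p\ge 0$ there is a constant $c=c(p)$, depending only on $p$, such that the following holds. Let $G$ be a finite group of order $n>1$, and let $\delta$ be the smallest dimension of a nontrivial representation of $G$. If $p\leq 1/\delta^{1/3}$, then every $p$-product-poor subset of $G$ has size at most $c\,n/\delta^{1/3}$.
   Context: Representations are finite-dimensional complex linear representations; a representation is nontrivial if some group element does not act as the identity. A subset $A$ of a group $G$ is called $p$-product-poor if the number of pairs $(a,b)\in A\times A$ such that $ab\in A$ is at most $p|A|^2$. *)

theory Defs
  imports Complex_Main "HOL-Algebra.Coset" "Jordan_Normal_Form.Matrix"
begin

text \<open>Fixing a basis, a complex representation on a \<open>d\<close>-dimensional space is a
  homomorphism into the group of units of the ring of complex \<open>d \<times> d\<close> matrices.\<close>

definition general_linear_group :: "nat \<Rightarrow> complex mat monoid" where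
  "general_linear_group d = units_of (ring_mat TYPE(complex) d ())"

definition representation ::
  "('a, 'b) monoid_scheme \<Rightarrow> nat \<Rightarrow> ('a \<Rightarrow> complex mat) \<Rightarrow> bool" where
  "representation G d \<rho> \<longleftrightarrow> \<rho> \<in> hom G (general_linear_group d)"

definition nontrivial_representation ::
  "('a, 'b) monoid_scheme \<Rightarrow> nat \<Rightarrow> ('a \<Rightarrow> complex mat) \<Rightarrow> bool" where
  "nontrivial_representation G d \<rho> \<longleftrightarrow>
     representation G d \<rho> \<and> (\<exists>g \<in> carrier G. \<rho> g \<noteq> 1\<^sub>m d)"

text \<open>A minimum over a nonempty set whenever \<open>G\<close> is a finite group with more than one
  element, since the regular representation is then nontrivial; it is positive because
  all \<open>0 \<times> 0\<close> matrices are equal.\<close>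

definition min_nontrivial_dim :: "('a, 'b) monoid_scheme \<Rightarrow> nat" where
  "min_nontrivial_dim G = (LEAST d. \<exists>\<rho>. nontrivial_representation G d \<rho>)"

definition product_poor :: "('a, 'b) monoid_scheme \<Rightarrow> real \<Rightarrow> 'a set \<Rightarrow> bool" where
  "product_poor G p A \<longleftrightarrow> A \<subseteq> carrier G \<and>
     real (card {(a, b). a \<in> A \<and> b \<in> A \<and> a \<otimes>\<^bsub>G\<^esub> b \<in> A}) \<le> p * (real (card A))\<^sup>2"

text \<open>A constant quantified inside a formula may depend on the type variable of the groups
  under consideration.  Statements about a constant valid for all finite groups therefore ask
  that it work both for all groups on an arbitrary type and for all groups on \<open>nat\<close>; the
  latter contain an isomorphic copy of every finite group, so the constant is uniform.\<close>

end

theory Submission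
  imports Defs "HOL-Analysis.Function_Topology" "HOL-Analysis.Convex"
begin

text \<open>Write \<open>n\<close> for the order of \<open>G\<close>, \<open>m\<close> for the size of \<open>A\<close>, \<open>\<delta>\<close> for the least dimension of a
  nontrivial representation, and let \<open>T f x = (\<Sum>a\<in>A. f (a x))\<close> act on real functions on \<open>G\<close>.
  The number of pairs in \<open>A \<times> A\<close> with product in \<open>A\<close> is \<open>\<langle>1\<^sub>A, T 1\<^sub>A\<rangle>\<close>.  Splitting \<open>1\<^sub>A\<close> into its mean
  \<open>m/n\<close> and a part \<open>f\<close> of mean zero gives \<open>m\<^sup>3/n + \<langle>1\<^sub>A, T f\<rangle>\<close>, so the count is close to its value
  for a random set as soon as \<open>T\<close> has small norm on functions of mean zero
  (\<open>product_count_lower_bound\<close>).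

  Such a norm bound comes from Gowers' observation that the largest singular value of \<open>T\<close> on
  these functions has multiplicity at least \<open>\<delta>\<close>.  Let \<open>l\<close> be the maximum of \<open>\<langle>T f, T f\<rangle>\<close> over the unit sphere of the
  functions of mean zero.  The quadratic form \<open>l \<langle>f, f\<rangle> - \<langle>T f, T f\<rangle>\<close> is nonnegative there, so its
  zeros form a linear subspace \<open>V \<noteq> 0\<close>.  Since \<open>T\<close> commutes
  with right translations, \<open>G\<close> acts on \<open>V\<close>, and it acts nontrivially because a
  translation-invariant function is constant and a constant of mean zero vanishes
  (\<open>nontrivial_representation_of_subspace\<close>).  Thus \<open>\<delta> \<le> d\<close> for \<open>d\<close> the dimension of \<open>V\<close>.  On the
  other hand an orthonormal basis of \<open>V\<close> contributes \<open>d l\<close> to the squared Hilbert-Schmidt norm of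
  \<open>T\<close>, which is \<open>n m\<close> (\<open>convolve_Hilbert_Schmidt\<close>).  Hence \<open>l \<le> n m / \<delta>\<close>
  (\<open>convolve_norm_bound\<close>).

  With Cauchy-Schwarz the number of pairs is at least \<open>m\<^sup>3/n - m sqrt (n m / \<delta>)\<close>.  If \<open>A\<close> is
  \<open>p\<close>-product-poor with \<open>p \<le> \<delta>\<close> to the power \<open>-1/3\<close>, and \<open>v\<close> is the ratio of \<open>m\<close> to the claimed
  order of magnitude, this becomes \<open>v (v - 1)\<^sup>2 \<le> 1\<close> whenever \<open>v \<ge> 1\<close>, which forces \<open>v \<le> 2\<close>.
  So \<open>c = 2\<close> serves for all \<open>p\<close>.\<close>

section \<open>Orthonormal systems of functions on a finite set\<close>

definition inner_on :: "'a set \<Rightarrow> ('a \<Rightarrow> real) \<Rightarrow> ('a \<Rightarrow> real) \<Rightarrow> real" where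
  "inner_on S f g = (\<Sum>x\<in>S. f x * g x)"

definition orthonormal_on :: "'a set \<Rightarrow> nat \<Rightarrow> (nat \<Rightarrow> 'a \<Rightarrow> real) \<Rightarrow> bool" where
  "orthonormal_on S d e \<longleftrightarrow>
     (\<forall>i<d. \<forall>j<d. inner_on S (e i) (e j) = (if i = j then 1 else 0))"

text \<open>Demanding the value \<open>0\<close> off \<open>S\<close> makes functions agreeing on \<open>S\<close> equal, so that
  \<^const>\<open>inner_on\<close> is definite on them when \<open>S\<close> is finite.\<close>

definition supported_on :: "'a set \<Rightarrow> ('a \<Rightarrow> real) set" where
  "supported_on S = {f. \<forall>x. x \<notin> S \<longrightarrow> f x = 0}"

definition function_subspace :: "('a \<Rightarrow> real) set \<Rightarrow> bool" where
  "function_subspace V \<longleftrightarrow> (\<lambda>x. 0) \<in> V \<and>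
     (\<forall>f\<in>V. \<forall>g\<in>V. \<forall>a b. (\<lambda>x. a * f x + b * g x) \<in> V)"

lemma inner_on_commute: "inner_on S f g = inner_on S g f"
  by (simp add: inner_on_def mult.commute)

lemma inner_on_nonneg: "0 \<le> inner_on S f f"
  by (simp add: inner_on_def sum_nonneg)

lemma inner_on_lincomb_left:
  "inner_on S (\<lambda>x. a * f x + b * g x) h = a * inner_on S f h + b * inner_on S g h"
  by (simp add: inner_on_def sum.distrib sum_distrib_left algebra_simps)

lemma inner_on_lincomb_right:
  "inner_on S h (\<lambda>x. a * f x + b * g x) = a * inner_on S h f + b * inner_on S h g"
  by (simp add: inner_on_def sum.distrib sum_distrib_left algebra_simps)

lemma inner_on_diff_left: "inner_on S (\<lambda>x. f x - g x) h = inner_on S f h - inner_on S g h"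
  by (simp add: inner_on_def sum_subtractf left_diff_distrib)

lemma inner_on_scale: "inner_on S (\<lambda>x. t * f x) (\<lambda>x. s * g x) = t * s * inner_on S f g"
  by (simp add: inner_on_def sum_distrib_left algebra_simps)

lemma inner_on_scale_left: "inner_on S (\<lambda>x. t * f x) g = t * inner_on S f g"
  by (simp add: inner_on_def sum_distrib_left algebra_simps)

lemma inner_on_sum_left:
  "inner_on S (\<lambda>x. \<Sum>i\<in>I. c i * e i x) h = (\<Sum>i\<in>I. c i * inner_on S (e i) h)"
  by (simp add: inner_on_def sum_distrib_left sum_distrib_right mult.assoc
      sum.swap[of _ I S])

lemma inner_on_eq_0_imp:
  assumes "finite S" "inner_on S f f = 0" "x \<in> S"
  shows "f x = 0"
  using assms by (simp add: inner_on_def sum_nonneg_eq_0_iff)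

lemma inner_on_Cauchy_Schwarz: "(inner_on S f g)\<^sup>2 \<le> inner_on S f f * inner_on S g g"
  using Cauchy_Schwarz_ineq_sum[of f g S] by (simp add: inner_on_def power2_eq_square)

lemma function_subspace_lincomb:
  "function_subspace V \<Longrightarrow> f \<in> V \<Longrightarrow> g \<in> V \<Longrightarrow> (\<lambda>x. a * f x + b * g x) \<in> V"
  by (simp add: function_subspace_def)

lemma function_subspace_scale:
  "function_subspace V \<Longrightarrow> f \<in> V \<Longrightarrow> (\<lambda>x. t * f x) \<in> V"
  using function_subspace_lincomb[of V f f t 0] by simp

lemma function_subspace_diff:
  "function_subspace V \<Longrightarrow> f \<in> V \<Longrightarrow> g \<in> V \<Longrightarrow> (\<lambda>x. f x - g x) \<in> V"
  using function_subspace_lincomb[of V f g 1 "-1"] by simp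

lemma function_subspace_sum:
  assumes V: "function_subspace V" and "finite I" "\<And>i. i \<in> I \<Longrightarrow> e i \<in> V"
  shows "(\<lambda>x. \<Sum>i\<in>I. c i * e i x) \<in> V"
  using assms(2,3)
proof (induction I rule: finite_induct)
  case empty
  then show ?case using V by (simp add: function_subspace_def)
next
  case (insert i I)
  then have "(\<lambda>x. c i * e i x + 1 * (\<Sum>i\<in>I. c i * e i x)) \<in> V"
    by (intro function_subspace_lincomb[OF V]) auto
  then show ?case using insert by simp
qed

definition residue_on :: "'a set \<Rightarrow> nat \<Rightarrow> (nat \<Rightarrow> 'a \<Rightarrow> real) \<Rightarrow> ('a \<Rightarrow> real) \<Rightarrow> 'a \<Rightarrow> real" where
  "residue_on S d e f = (\<lambda>x. f x - (\<Sum>i<d. inner_on S f (e i) * e i x))"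

lemma residue_on_orthogonal:
  assumes "orthonormal_on S d e" "j < d"
  shows "inner_on S (residue_on S d e f) (e j) = 0"
proof -
  have "(\<Sum>i<d. inner_on S f (e i) * inner_on S (e i) (e j)) =
        (\<Sum>i<d. if i = j then inner_on S f (e j) else 0)"
    using assms by (intro sum.cong) (auto simp: orthonormal_on_def)
  then show ?thesis using assms(2)
    unfolding residue_on_def inner_on_diff_left inner_on_sum_left by simp
qed

lemma inner_residue_on:
  assumes "orthonormal_on S d e"
  shows "inner_on S (residue_on S d e f) (residue_on S d e f) =
         inner_on S f f - (\<Sum>i<d. (inner_on S f (e i))\<^sup>2)"
proof -
  let ?r = "residue_on S d e f"
  have "inner_on S ?r ?r = inner_on S f ?r - (\<Sum>i<d. inner_on S f (e i) * inner_on S (e i) ?r)"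
    by (subst (1) residue_on_def) (simp add: inner_on_diff_left inner_on_sum_left)
  also have "(\<Sum>i<d. inner_on S f (e i) * inner_on S (e i) ?r) = 0"
    using residue_on_orthogonal[OF assms] by (intro sum.neutral) (simp add: inner_on_commute)
  also have "inner_on S f ?r = inner_on S ?r f" by (rule inner_on_commute)
  also have "\<dots> = inner_on S f f - (\<Sum>i<d. inner_on S f (e i) * inner_on S (e i) f)"
    unfolding residue_on_def inner_on_diff_left inner_on_sum_left by simp
  finally show ?thesis by (simp add: inner_on_commute[of S "e _" f] power2_eq_square)
qed

lemma Bessel_on:
  assumes "orthonormal_on S d e"
  shows "(\<Sum>i<d. (inner_on S f (e i))\<^sup>2) \<le> inner_on S f f"
  using inner_residue_on[OF assms, of f] inner_on_nonneg[of S "residue_on S d e f"] by simp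

text \<open>Bessel's inequality for the indicator of a point \<open>x\<close> bounds \<open>\<Sum>i<d. (e i x)\<^sup>2\<close> by \<open>1\<close>.
  Summed over \<open>x\<close> this bounds \<open>d\<close>.\<close>

lemma orthonormal_on_card:
  assumes "finite S" "orthonormal_on S d e"
  shows "d \<le> card S"
proof -
  have "(\<Sum>i<d. (e i x)\<^sup>2) \<le> 1" if "x \<in> S" for x
  proof -
    have *: "inner_on S (\<lambda>y. if y = x then 1 else 0) g = g x" for g
      using assms(1) that by (simp add: inner_on_def if_distrib[of "\<lambda>t. t * _"] cong: if_cong)
    show ?thesis using Bessel_on[OF assms(2), of "\<lambda>y. if y = x then 1 else 0"] by (simp add: *)
  qed
  then have "(\<Sum>x\<in>S. \<Sum>i<d. (e i x)\<^sup>2) \<le> (\<Sum>x\<in>S. 1)" by (intro sum_mono)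
  also have "(\<Sum>x\<in>S. \<Sum>i<d. (e i x)\<^sup>2) = (\<Sum>i<d. inner_on S (e i) (e i))"
    by (simp add: inner_on_def power2_eq_square sum.swap[of _ S])
  also have "\<dots> = real d" using assms(2) by (simp add: orthonormal_on_def)
  finally show ?thesis by simp
qed

text \<open>An orthonormal system in \<open>V\<close> of the largest possible size is a basis: a vector with
  nonzero residue would, after normalising the residue, extend the system.\<close>

lemma orthonormal_basis_exists:
  assumes fin: "finite S" and V: "function_subspace V" and supp: "V \<subseteq> supported_on S"
  shows "\<exists>d e. orthonormal_on S d e \<and> (\<forall>i<d. e i \<in> V) \<and>
    (\<forall>f\<in>V. \<forall>x. f x = (\<Sum>i<d. inner_on S f (e i) * e i x))"
proof -
  let ?P = "\<lambda>d. \<exists>e. orthonormal_on S d e \<and> (\<forall>i<d. e i \<in> V)"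
  define d where "d = Greatest ?P"
  have P0: "?P 0" by (simp add: orthonormal_on_def)
  have bound: "k \<le> card S" if "?P k" for k
    using that orthonormal_on_card[OF fin] by blast
  have "?P d"
    unfolding d_def by (rule GreatestI_nat[where P = ?P and k = 0, OF P0]) (use bound in blast)
  then obtain e where e: "orthonormal_on S d e" "\<And>i. i < d \<Longrightarrow> e i \<in> V" by blast
  have "f x = (\<Sum>i<d. inner_on S f (e i) * e i x)" if f: "f \<in> V" for f x
  proof -
    let ?r = "residue_on S d e f"
    have rV: "?r \<in> V"
      unfolding residue_on_def
      by (intro function_subspace_diff[OF V] f function_subspace_sum[OF V]) (auto simp: e(2))
    have "inner_on S ?r ?r = 0"
    proof (rule ccontr)
      assume "inner_on S ?r ?r \<noteq> 0"
      then have pos: "inner_on S ?r ?r > 0" using inner_on_nonneg[of S ?r] by linarith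
      define t where "t = 1 / sqrt (inner_on S ?r ?r)"
      have t2: "t * t * inner_on S ?r ?r = 1"
        using pos by (simp add: t_def field_simps)
      define u where "u = (\<lambda>x. t * ?r x)"
      have uV: "u \<in> V" unfolding u_def by (rule function_subspace_scale[OF V rV])
      have ue: "inner_on S u (e j) = 0" if "j < d" for j
        using residue_on_orthogonal[OF e(1) that] unfolding u_def inner_on_scale_left by simp
      have ue': "inner_on S (e j) u = 0" if "j < d" for j
        using ue[OF that] by (simp add: inner_on_commute)
      have uu: "inner_on S u u = 1"
        using t2 unfolding u_def inner_on_scale .
      have "orthonormal_on S (Suc d) (e(d := u))"
        using e(1) ue ue' uu by (auto simp: orthonormal_on_def less_Suc_eq)
      moreover have "\<forall>i<Suc d. (e(d := u)) i \<in> V"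
        using e(2) uV by (auto simp: less_Suc_eq)
      ultimately have "?P (Suc d)" by blast
      then have "Suc d \<le> d" unfolding d_def by (rule Greatest_le_nat[where P = ?P]) (use bound in blast)
      then show False by simp
    qed
    then have "?r x = 0"
      using inner_on_eq_0_imp[OF fin, of ?r x] rV supp by (cases "x \<in> S") (auto simp: supported_on_def)
    then show ?thesis by (simp add: residue_on_def)
  qed
  then show ?thesis using e by blast
qed

section \<open>Translation-invariant subspaces as representations\<close>

lemma min_nontrivial_dim_le:
  "nontrivial_representation H d \<rho> \<Longrightarrow> min_nontrivial_dim H \<le> d"
  unfolding min_nontrivial_dim_def by (rule Least_le) blast

text \<open>In dimension \<open>0\<close> the identity is the only matrix, so every representation is trivial.\<close>

lemma min_nontrivial_dim_pos:
  assumes "nontrivial_representation H d \<rho>"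
  shows "0 < min_nontrivial_dim H"
proof -
  have "\<exists>\<sigma>. nontrivial_representation H (min_nontrivial_dim H) \<sigma>"
    unfolding min_nontrivial_dim_def by (rule LeastI) (use assms in blast)
  then obtain \<sigma> g where "representation H (min_nontrivial_dim H) \<sigma>"
    and g: "g \<in> carrier H" "\<sigma> g \<noteq> 1\<^sub>m (min_nontrivial_dim H)"
    unfolding nontrivial_representation_def by blast
  then have "\<sigma> g \<in> carrier_mat (min_nontrivial_dim H) (min_nontrivial_dim H)"
    by (auto simp: representation_def hom_def general_linear_group_def units_of_def Units_def
        ring_mat_def)
  then show ?thesis using g(2) by (cases "min_nontrivial_dim H = 0") auto
qed

definition mean_zero_on :: "'a set \<Rightarrow> ('a \<Rightarrow> real) set" where
  "mean_zero_on S = {f \<in> supported_on S. sum f S = 0}"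

text \<open>Right translation, for which \<open>g \<mapsto> translate G g\<close> is a homomorphism rather than an
  antihomomorphism.\<close>

definition translate :: "('a, 'b) monoid_scheme \<Rightarrow> 'a \<Rightarrow> ('a \<Rightarrow> real) \<Rightarrow> 'a \<Rightarrow> real" where
  "translate G g f = (\<lambda>x. if x \<in> carrier G then f (x \<otimes>\<^bsub>G\<^esub> g) else 0)"

context group
begin

lemma sum_translate_right:
  assumes "g \<in> carrier G"
  shows "(\<Sum>x\<in>carrier G. h (x \<otimes> g)) = sum h (carrier G)"
proof (rule sum.reindex_bij_witness[where i = "\<lambda>x. x \<otimes> inv g" and j = "\<lambda>x. x \<otimes> g"])
qed (use assms in \<open>auto simp: m_assoc\<close>)

lemma inner_on_translate:
  assumes "g \<in> carrier G"
  shows "inner_on (carrier G) (translate G g f) (translate G g h) = inner_on (carrier G) f h"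
  using sum_translate_right[OF assms, of "\<lambda>x. f x * h x"] by (simp add: inner_on_def translate_def)

lemma translate_mean_zero:
  assumes "g \<in> carrier G" "f \<in> mean_zero_on (carrier G)"
  shows "translate G g f \<in> mean_zero_on (carrier G)"
  using assms sum_translate_right[OF assms(1), of f]
  by (simp add: mean_zero_on_def supported_on_def translate_def)

text \<open>The matrices of the translations in the orthonormal basis \<open>e\<close> form a representation.  If
  it were trivial, every translation would fix \<open>e 0\<close>, so \<open>e 0\<close> would be constant; having mean
  zero it would vanish.\<close>

lemma nontrivial_representation_of_subspace:
  assumes fin: "finite (carrier G)"
    and V: "function_subspace V" "V \<subseteq> mean_zero_on (carrier G)"
    and inv: "\<And>g f. g \<in> carrier G \<Longrightarrow> f \<in> V \<Longrightarrow> translate G g f \<in> V"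
    and e: "orthonormal_on (carrier G) d e" "\<And>i. i < d \<Longrightarrow> e i \<in> V"
      "\<And>f x. f \<in> V \<Longrightarrow> f x = (\<Sum>i<d. inner_on (carrier G) f (e i) * e i x)"
    and d: "0 < d"
  shows "\<exists>\<rho>. nontrivial_representation G d \<rho>"
proof -
  let ?S = "carrier G"
  define c where "c = (\<lambda>g i j. inner_on ?S (translate G g (e j)) (e i))"
  define \<rho> where "\<rho> = (\<lambda>g. mat d d (\<lambda>(i, j). complex_of_real (c g i j)))"
  have expand: "translate G g (e j) x = (\<Sum>i<d. c g i j * e i x)" if "g \<in> ?S" "j < d" for g j x
    using e(3)[OF inv[OF that(1) e(2)[OF that(2)]]] by (simp add: c_def)
  have c_mult: "c (g \<otimes> h) i j = (\<Sum>k<d. c g i k * c h k j)"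
    if gh: "g \<in> ?S" "h \<in> ?S" and "j < d" for g h i j
  proof -
    have "translate G (g \<otimes> h) (e j) = (\<lambda>x. \<Sum>k<d. c h k j * translate G g (e k) x)"
    proof
      fix x
      show "translate G (g \<otimes> h) (e j) x = (\<Sum>k<d. c h k j * translate G g (e k) x)"
        using gh expand[OF gh(2) \<open>j < d\<close>, of "x \<otimes> g"]
        by (auto simp: translate_def m_assoc)
    qed
    then have "c (g \<otimes> h) i j = (\<Sum>k<d. c h k j * inner_on ?S (translate G g (e k)) (e i))"
      by (simp only: c_def inner_on_sum_left)
    then show ?thesis by (simp add: c_def mult.commute)
  qed
  have c_one: "c \<one> i j = (if i = j then 1 else 0)" if "i < d" "j < d" for i j
  proof -
    have "inner_on ?S (translate G \<one> (e j)) (e i) = inner_on ?S (e j) (e i)"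
      by (simp add: inner_on_def translate_def)
    then show ?thesis using e(1) that by (auto simp: c_def orthonormal_on_def)
  qed
  have car: "\<rho> g \<in> carrier_mat d d" for g by (simp add: \<rho>_def)
  have \<rho>_mult: "\<rho> (g \<otimes> h) = \<rho> g * \<rho> h" if "g \<in> ?S" "h \<in> ?S" for g h
    by (rule eq_matI)
      (auto simp: \<rho>_def scalar_prod_def c_mult[OF that] lessThan_atLeast0)
  have \<rho>_one: "\<rho> \<one> = 1\<^sub>m d"
    by (rule eq_matI) (auto simp: \<rho>_def c_one)
  have unit: "\<rho> g \<in> Units (ring_mat TYPE(complex) d ())" if "g \<in> ?S" for g
  proof -
    have "\<rho> (inv g) * \<rho> g = 1\<^sub>m d" "\<rho> g * \<rho> (inv g) = 1\<^sub>m d"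
      using that by (simp_all flip: \<rho>_mult add: \<rho>_one)
    then show ?thesis using car by (auto simp: Units_def ring_mat_def)
  qed
  have "\<rho> \<in> hom G (general_linear_group d)"
    using unit \<rho>_mult
    by (auto simp: hom_def general_linear_group_def units_of_def ring_mat_def)
  moreover have "\<exists>g\<in>?S. \<rho> g \<noteq> 1\<^sub>m d"
  proof (rule ccontr)
    assume "\<not> ?thesis"
    then have triv: "\<rho> g = 1\<^sub>m d" if "g \<in> ?S" for g using that by blast
    have cd: "c g i 0 = (if i = 0 then 1 else 0)" if "g \<in> ?S" "i < d" for g i
    proof -
      have "\<rho> g $$ (i, 0) = (1\<^sub>m d :: complex mat) $$ (i, 0)" using triv[OF that(1)] by simp
      then show ?thesis using that d by (simp add: \<rho>_def split: if_splits)
    qed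
    have const: "e 0 g = e 0 \<one>" if "g \<in> ?S" for g
    proof -
      have "translate G g (e 0) \<one> = (\<Sum>i<d. if i = 0 then e 0 \<one> else 0)"
        unfolding expand[OF that d] by (intro sum.cong) (auto simp: cd[OF that])
      then show ?thesis using that d by (simp add: translate_def)
    qed
    have "sum (e 0) ?S = 0" using e(2)[OF d] V(2) by (auto simp: mean_zero_on_def)
    moreover have "sum (e 0) ?S = (\<Sum>x\<in>?S. e 0 \<one>)" by (intro sum.cong refl const)
    ultimately have "real (card ?S) * e 0 \<one> = 0" by simp
    then have "e 0 \<one> = 0" using fin one_closed by (auto simp: card_eq_0_iff)
    then have "e 0 x = 0" if "x \<in> ?S" for x using const[OF that] by simp
    then have "inner_on ?S (e 0) (e 0) = 0" by (simp add: inner_on_def)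
    then show False using e(1) d by (simp add: orthonormal_on_def)
  qed
  ultimately show ?thesis
    unfolding nontrivial_representation_def representation_def by blast
qed

end

section \<open>The norm of convolution on functions of mean zero\<close>

text \<open>In the product topology on functions the sphere is a closed subset of the cube
  \<open>[-1, 1]\<close> to the power \<open>UNIV\<close>, which is compact by Tychonoff's theorem.\<close>

lemma compact_mean_zero_sphere:
  assumes fin: "finite S"
  shows "compact {f \<in> mean_zero_on S. inner_on S f f = 1}"
proof -
  let ?B = "PiE UNIV (\<lambda>x::'a. {-1..1::real})"
  have cont: "continuous_on UNIV (\<lambda>f::'a \<Rightarrow> real. f x)" for x by simp
  have "compactin (product_topology (\<lambda>x::'a. euclidean) UNIV) ?B"
    by (simp add: compactin_PiE)
  then have comp: "compact ?B" by (simp add: euclidean_product_topology)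
  have "closed (\<Inter>x\<in>-S. {f::'a \<Rightarrow> real. f x = 0})"
    by (intro closed_INT ballI closed_Collect_eq continuous_intros cont)
  moreover have "closed {f::'a \<Rightarrow> real. sum f S = 0}"
    by (intro closed_Collect_eq continuous_intros cont)
  moreover have "closed {f::'a \<Rightarrow> real. inner_on S f f = 1}"
    unfolding inner_on_def by (intro closed_Collect_eq continuous_intros cont)
  ultimately have "compact (?B \<inter> ((\<Inter>x\<in>-S. {f. f x = 0}) \<inter> ({f. sum f S = 0} \<inter> {f. inner_on S f f = 1})))"
    by (intro compact_Int_closed comp closed_Int)
  also have "?B \<inter> ((\<Inter>x\<in>-S. {f. f x = 0}) \<inter> ({f. sum f S = 0} \<inter> {f. inner_on S f f = 1}))
     = {f \<in> mean_zero_on S. inner_on S f f = 1}" (is "?L = ?R")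
  proof -
    have "f x \<in> {-1..1}" if "f \<in> ?R" for f x
    proof (cases "x \<in> S")
      case True
      have "f x * f x \<le> inner_on S f f"
        unfolding inner_on_def by (rule member_le_sum[OF True _ fin]) auto
      then have "(f x)\<^sup>2 \<le> 1" using that by (simp add: power2_eq_square)
      then show ?thesis by (simp add: abs_square_le_1 abs_le_iff)
    qed (use that in \<open>auto simp: mean_zero_on_def supported_on_def\<close>)
    then show ?thesis by (auto simp: mean_zero_on_def supported_on_def PiE_def Pi_def)
  qed
  finally show ?thesis .
qed

definition convolve :: "('a, 'b) monoid_scheme \<Rightarrow> 'a set \<Rightarrow> ('a \<Rightarrow> real) \<Rightarrow> 'a \<Rightarrow> real" where
  "convolve G A f = (\<lambda>x. \<Sum>a\<in>A. f (a \<otimes>\<^bsub>G\<^esub> x))"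

lemma convolve_lincomb:
  "convolve G A (\<lambda>x. a * f x + b * g x) = (\<lambda>x. a * convolve G A f x + b * convolve G A g x)"
  by (simp add: convolve_def sum.distrib sum_distrib_left)

lemma convolve_scale: "convolve G A (\<lambda>x. t * f x) = (\<lambda>x. t * convolve G A f x)"
  by (simp add: convolve_def sum_distrib_left)

lemma function_subspace_mean_zero: "function_subspace (mean_zero_on S)"
  by (auto simp: function_subspace_def mean_zero_on_def supported_on_def sum.distrib
      simp flip: sum_distrib_left)

context group
begin

text \<open>\<^const>\<open>convolve\<close> multiplies the argument on the left and \<^const>\<open>translate\<close> on the right,
  so the two commute by associativity.\<close>

lemma convolve_translate:
  assumes "g \<in> carrier G" "A \<subseteq> carrier G" "x \<in> carrier G"
  shows "convolve G A (translate G g f) x = translate G g (convolve G A f) x"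
  using assms by (auto simp: convolve_def translate_def m_assoc subset_iff intro!: sum.cong)

text \<open>The row of the matrix of \<open>convolve G A\<close> at \<open>x\<close> is the indicator of the translate
  \<open>A x\<close>, of squared norm \<open>card A\<close>.  Bessel's inequality, applied to each row, bounds the left-hand
  side by the squared Hilbert-Schmidt norm.\<close>

lemma convolve_Hilbert_Schmidt:
  assumes fin: "finite (carrier G)" and A: "A \<subseteq> carrier G"
    and e: "orthonormal_on (carrier G) d e"
  shows "(\<Sum>i<d. inner_on (carrier G) (convolve G A (e i)) (convolve G A (e i)))
           \<le> real (order G) * real (card A)"
proof -
  let ?S = "carrier G"
  have row: "(\<Sum>i<d. (convolve G A (e i) x)\<^sup>2) \<le> real (card A)" if x: "x \<in> ?S" for x
  proof -
    let ?Ax = "(\<lambda>a. a \<otimes> x) ` A"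
    let ?m = "\<lambda>y. if y \<in> ?Ax then 1 else 0 :: real"
    have sub: "?Ax \<subseteq> ?S" using A x by auto
    have inj: "inj_on (\<lambda>a. a \<otimes> x) A" using A x by (auto intro!: inj_onI simp: subset_iff)
    have m: "inner_on ?S ?m g = sum g ?Ax" for g
    proof -
      have "inner_on ?S ?m g = (\<Sum>y\<in>?S. if y \<in> ?Ax then g y else 0)"
        unfolding inner_on_def by (intro sum.cong) auto
      also have "\<dots> = sum g (?S \<inter> ?Ax)" by (rule sum.inter_restrict[OF fin, symmetric])
      finally show ?thesis using sub by (simp add: Int_absorb1)
    qed
    have "inner_on ?S ?m ?m = real (card A)"
      unfolding m using card_image[OF inj] by simp
    moreover have "inner_on ?S ?m g = convolve G A g x" for g
      unfolding m convolve_def by (simp add: sum.reindex[OF inj])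
    ultimately show ?thesis using Bessel_on[OF e, of ?m] by simp
  qed
  have "(\<Sum>i<d. inner_on ?S (convolve G A (e i)) (convolve G A (e i))) =
        (\<Sum>x\<in>?S. \<Sum>i<d. (convolve G A (e i) x)\<^sup>2)"
    by (simp add: inner_on_def power2_eq_square sum.swap[of _ ?S])
  also have "\<dots> \<le> (\<Sum>x\<in>?S. real (card A))" by (intro sum_mono row)
  finally show ?thesis by (simp add: order_def)
qed

text \<open>Here \<open>l\<close> is the squared operator norm of convolution on functions of mean zero and \<open>d\<close>
  is its multiplicity, the dimension of the space \<open>V\<close> of functions attaining it.  The nontrivial
  representation on \<open>V\<close> also shows that \<^const>\<open>min_nontrivial_dim\<close> is a genuine minimum.\<close>

lemma convolve_norm_bound_representation:
  assumes fin: "finite (carrier G)" and ord: "order G > 1" and A: "A \<subseteq> carrier G"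
  shows "\<exists>d \<rho> l. nontrivial_representation G d \<rho> \<and>
    real d * l \<le> real (order G) * real (card A) \<and> 0 \<le> l \<and>
    (\<forall>f\<in>mean_zero_on (carrier G).
       inner_on (carrier G) (convolve G A f) (convolve G A f) \<le> l * inner_on (carrier G) f f)"
proof -
  let ?S = "carrier G" and ?W = "mean_zero_on (carrier G)"
  let ?T = "convolve G A"
  let ?Q = "\<lambda>f. inner_on ?S (?T f) (?T f)"
  let ?K = "{f \<in> ?W. inner_on ?S f f = 1}"
  have normalise: "(\<lambda>x. (1 / sqrt (inner_on ?S f f)) * f x) \<in> ?K"
    if "f \<in> ?W" "inner_on ?S f f > 0" for f
    using that(2)
    unfolding mem_Collect_eq inner_on_scale
    by (intro conjI function_subspace_scale[OF function_subspace_mean_zero that(1)]) simp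
  obtain x where x: "x \<in> ?S" "x \<noteq> \<one>"
  proof -
    have "?S \<noteq> {\<one>}" using ord by (auto simp: order_def)
    then show thesis using that by blast
  qed
  \<comment> \<open>A nonzero function of mean zero, which exists because \<open>G\<close> has two elements; it makes the
    sphere \<open>?K\<close> nonempty.\<close>
  define f0 where "f0 = (\<lambda>y. if y = \<one> then 1 else if y = x then -1 else 0 :: real)"
  have f0: "f0 \<in> ?W"
  proof -
    have "sum f0 ?S = (\<Sum>y\<in>?S. (if y = \<one> then 1 else 0) - (if y = x then 1 else 0))"
      unfolding f0_def using x by (intro sum.cong) auto
    then have "sum f0 ?S = 0" using x fin by (simp add: sum_subtractf)
    then show ?thesis using x by (auto simp: mean_zero_on_def supported_on_def f0_def)
  qed
  have "f0 \<one> = 1" by (simp add: f0_def)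
  then have "inner_on ?S f0 f0 \<noteq> 0" using inner_on_eq_0_imp[OF fin, of f0 \<one>] by auto
  then have "inner_on ?S f0 f0 > 0" using inner_on_nonneg[of ?S f0] by linarith
  then have "?K \<noteq> {}" using normalise[OF f0] by blast
  moreover have "continuous_on ?K ?Q"
  proof -
    have coord: "continuous_on UNIV (\<lambda>f::'a \<Rightarrow> real. f x)" for x by simp
    have "continuous_on UNIV ?Q"
      unfolding inner_on_def convolve_def by (intro continuous_intros coord)
    then show ?thesis by (rule continuous_on_subset) simp
  qed
  ultimately have "\<exists>fm\<in>?K. \<forall>f\<in>?K. ?Q f \<le> ?Q fm"
    by (intro continuous_attains_sup compact_mean_zero_sphere[OF fin])
  then obtain fm where fm: "fm \<in> ?K" and max: "\<And>f. f \<in> ?K \<Longrightarrow> ?Q f \<le> ?Q fm"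
    by blast
  define l where "l = ?Q fm"
  have le: "?Q f \<le> l * inner_on ?S f f" if f: "f \<in> ?W" for f
  proof (cases "inner_on ?S f f = 0")
    case True
    then have "f y = 0" for y
      using inner_on_eq_0_imp[OF fin True] f
      by (cases "y \<in> ?S") (auto simp: mean_zero_on_def supported_on_def)
    then have "?Q f = 0" by (simp add: inner_on_def convolve_def)
    then show ?thesis using True by simp
  next
    case False
    then have pos: "inner_on ?S f f > 0" using inner_on_nonneg[of ?S f] by linarith
    define t where "t = 1 / sqrt (inner_on ?S f f)"
    have "?Q (\<lambda>x. t * f x) \<le> l"
      using max[OF normalise[OF f pos]] unfolding t_def l_def .
    then have "t * t * ?Q f \<le> l"
      unfolding convolve_scale inner_on_scale .
    then show ?thesis using pos by (simp add: t_def field_simps)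
  qed
  define V where "V = {f \<in> ?W. ?Q f = l * inner_on ?S f f}"
  have "function_subspace V"
    unfolding function_subspace_def
  proof (intro conjI ballI allI)
    show "(\<lambda>x. 0) \<in> V"
      by (simp add: V_def mean_zero_on_def supported_on_def inner_on_def convolve_def)
    fix f g a b assume f: "f \<in> V" and g: "g \<in> V"
    have W: "(\<lambda>x. a * f x + b * g x) \<in> ?W" for a b
      using f g
      by (intro function_subspace_lincomb[OF function_subspace_mean_zero]) (simp_all add: V_def)
    \<comment> \<open>\<open>C\<close> is the polar form of \<open>l * inner_on ?S f f - ?Q f\<close>.  As \<open>f\<close> and \<open>g\<close> are zeros of this form,
      only the cross term survives in \<open>form\<close>, and nonnegativity at \<open>f + g\<close> and \<open>f - g\<close> forces
      \<open>C = 0\<close>.\<close>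
    define C where "C = l * inner_on ?S f g - inner_on ?S (?T f) (?T g)"
    have form: "l * inner_on ?S (\<lambda>x. a * f x + b * g x) (\<lambda>x. a * f x + b * g x)
        - ?Q (\<lambda>x. a * f x + b * g x) = 2 * a * b * C" for a b
      unfolding C_def convolve_lincomb inner_on_lincomb_left inner_on_lincomb_right
      using f g by (simp add: V_def inner_on_commute[of ?S g f]
          inner_on_commute[of ?S "?T g" "?T f"] algebra_simps)
    have "0 \<le> C" using le[OF W[of 1 1]] form[of 1 1] by linarith
    moreover have "C \<le> 0" using le[OF W[of 1 "-1"]] form[of 1 "-1"] by linarith
    ultimately have "C = 0" by simp
    then show "(\<lambda>x. a * f x + b * g x) \<in> V"
      using W[of a b] form[of a b] by (simp add: V_def)
  qed
  note V = this
  have V_inv: "translate G g f \<in> V" if "g \<in> ?S" "f \<in> V" for g f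
  proof -
    have "?Q (translate G g f) = ?Q f"
      using inner_on_translate[OF that(1), of "?T f" "?T f"] convolve_translate[OF that(1) A]
      by (simp add: inner_on_def)
    then show ?thesis
      using that translate_mean_zero by (simp add: V_def inner_on_translate)
  qed
  have VW: "V \<subseteq> ?W" by (auto simp: V_def)
  then have V_supp: "V \<subseteq> supported_on ?S" by (auto simp: mean_zero_on_def)
  obtain d e where e: "orthonormal_on ?S d e" "\<And>i. i < d \<Longrightarrow> e i \<in> V"
    "\<And>f x. f \<in> V \<Longrightarrow> f x = (\<Sum>i<d. inner_on ?S f (e i) * e i x)"
    using orthonormal_basis_exists[OF fin V V_supp] by blast
  have "fm \<in> V" using fm by (simp add: V_def l_def)
  have "d \<noteq> 0"
  proof
    assume "d = 0"
    then have "inner_on ?S fm fm = 0" using e(3)[OF \<open>fm \<in> V\<close>] by (simp add: inner_on_def)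
    then show False using fm by simp
  qed
  then obtain \<rho> where \<rho>: "nontrivial_representation G d \<rho>"
    using nontrivial_representation_of_subspace[OF fin V VW V_inv e] by auto
  have "real d * l = (\<Sum>i<d. ?Q (e i))"
    using e(1,2) by (simp add: V_def orthonormal_on_def)
  then have "real d * l \<le> real (order G) * real (card A)"
    using convolve_Hilbert_Schmidt[OF fin A e(1)] by simp
  moreover have "0 \<le> l" unfolding l_def by (rule inner_on_nonneg)
  ultimately show ?thesis
    by (intro exI[of _ d] exI[of _ \<rho>] exI[of _ l] conjI ballI \<rho> le)
qed

lemma min_nontrivial_dim_group_pos:
  assumes "finite (carrier G)" "order G > 1"
  shows "0 < min_nontrivial_dim G"
  using convolve_norm_bound_representation[OF assms empty_subsetI]
  by (elim exE conjE) (rule min_nontrivial_dim_pos)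

lemma convolve_norm_bound:
  assumes "finite (carrier G)" "order G > 1" "A \<subseteq> carrier G" "f \<in> mean_zero_on (carrier G)"
  shows "real (min_nontrivial_dim G) * inner_on (carrier G) (convolve G A f) (convolve G A f)
           \<le> real (order G) * real (card A) * inner_on (carrier G) f f"
proof -
  obtain d \<rho> l where *: "nontrivial_representation G d \<rho>"
    "real d * l \<le> real (order G) * real (card A)" "0 \<le> l"
    "inner_on (carrier G) (convolve G A f) (convolve G A f) \<le> l * inner_on (carrier G) f f"
    using convolve_norm_bound_representation[OF assms(1-3)]
    by (elim exE conjE) (drule bspec[OF _ assms(4)], rule that)
  have "real (min_nontrivial_dim G) * inner_on (carrier G) (convolve G A f) (convolve G A f)
        \<le> real d * (l * inner_on (carrier G) f f)"
    using * min_nontrivial_dim_le[OF *(1)] by (intro mult_mono) (auto simp: inner_on_nonneg)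
  also have "\<dots> \<le> real (order G) * real (card A) * inner_on (carrier G) f f"
    using mult_right_mono[OF *(2) inner_on_nonneg] by (simp add: mult.assoc)
  finally show ?thesis .
qed

section \<open>Counting products inside a set\<close>

text \<open>The first term is the expected count for a random set of the density of \<open>A\<close>.  The
  indicator \<open>u\<close> of \<open>A\<close> splits into the constant \<open>card A / order G\<close>, which gives that term, and \<open>f\<close>
  of mean zero, whose contribution \<open>convolve_norm_bound\<close> and Cauchy-Schwarz control.\<close>

lemma product_count_lower_bound:
  assumes fin: "finite (carrier G)" and ord: "order G > 1" and A: "A \<subseteq> carrier G"
  shows "(real (card A))\<^sup>2 * (real (card A) / real (order G))
           - real (card A) * sqrt (real (order G) * real (card A) / real (min_nontrivial_dim G))
         \<le> real (card {(a, b). a \<in> A \<and> b \<in> A \<and> a \<otimes> b \<in> A})"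
proof -
  let ?S = "carrier G"
  let ?n = "real (order G)" and ?m = "real (card A)" and ?\<delta> = "real (min_nontrivial_dim G)"
  let ?N = "real (card {(a, b). a \<in> A \<and> b \<in> A \<and> a \<otimes> b \<in> A})"
  have finA: "finite A" using A fin finite_subset by blast
  have n: "?n > 0" using ord by simp
  have n_card: "real (card ?S) = ?n" by (simp add: order_def)
  have \<delta>: "?\<delta> > 0"
    using min_nontrivial_dim_group_pos[OF fin ord] by simp
  define u where "u = (\<lambda>x. if x \<in> A then 1 else 0 :: real)"
  define f where "f = (\<lambda>x. if x \<in> ?S then u x - ?m / ?n else 0)"
  have u: "inner_on ?S u g = sum g A" for g
  proof -
    have "inner_on ?S u g = (\<Sum>x\<in>?S. if x \<in> A then g x else 0)"
      unfolding inner_on_def u_def by (intro sum.cong) auto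
    also have "\<dots> = sum g (?S \<inter> A)" by (rule sum.inter_restrict[OF fin, symmetric])
    finally show ?thesis using A by (simp add: Int_absorb1)
  qed
  have uu: "inner_on ?S u u = ?m" unfolding u by (simp add: u_def)
  have sum_u: "sum u ?S = ?m"
    using u[of "\<lambda>_. 1"] by (simp add: inner_on_def)
  have f: "f \<in> mean_zero_on ?S"
    using n by (simp add: mean_zero_on_def supported_on_def f_def sum_subtractf sum_u n_card)
  have ff: "inner_on ?S f f \<le> ?m"
  proof -
    have "inner_on ?S f f = (\<Sum>x\<in>?S. u x * u x - (2 * (?m / ?n)) * u x + (?m / ?n)\<^sup>2)"
      unfolding inner_on_def f_def
      by (intro sum.cong) (auto simp: power2_eq_square algebra_simps)
    also have "\<dots> = ?m - 2 * (?m / ?n) * ?m + ?n * (?m / ?n)\<^sup>2"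
      using uu sum_u unfolding sum.distrib sum_subtractf sum_distrib_left[symmetric]
      by (simp add: n_card inner_on_def)
    also have "\<dots> = ?m - ?m\<^sup>2 / ?n" using n by (simp add: power2_eq_square field_simps)
    also have "\<dots> \<le> ?m" by simp
    finally show ?thesis .
  qed
  have "?N = (\<Sum>b\<in>A. convolve G A u b)"
  proof -
    have "{(a, b). a \<in> A \<and> b \<in> A \<and> a \<otimes> b \<in> A} = {p \<in> A \<times> A. fst p \<otimes> snd p \<in> A}" by auto
    then have "?N = (\<Sum>p\<in>A \<times> A. u (fst p \<otimes> snd p))"
      using finA by (simp add: u_def sum.If_cases Int_def)
    also have "\<dots> = (\<Sum>a\<in>A. \<Sum>b\<in>A. u (a \<otimes> b))"
      by (simp add: sum.cartesian_product case_prod_unfold)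
    also have "\<dots> = (\<Sum>b\<in>A. convolve G A u b)"
      unfolding convolve_def by (rule sum.swap)
    finally show ?thesis .
  qed
  also have "\<dots> = (\<Sum>b\<in>A. convolve G A f b + ?m * (?m / ?n))"
  proof (intro sum.cong refl)
    fix b assume "b \<in> A"
    then have "convolve G A f b = (\<Sum>a\<in>A. u (a \<otimes> b) - ?m / ?n)"
      unfolding convolve_def f_def using A by (intro sum.cong) auto
    then show "convolve G A u b = convolve G A f b + ?m * (?m / ?n)"
      by (simp add: convolve_def sum_subtractf)
  qed
  also have "\<dots> = inner_on ?S u (convolve G A f) + ?m\<^sup>2 * (?m / ?n)"
    by (simp add: u sum.distrib power2_eq_square)
  finally have N: "?N = inner_on ?S u (convolve G A f) + ?m\<^sup>2 * (?m / ?n)" .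
  have "inner_on ?S (convolve G A f) (convolve G A f) \<le> ?n * ?m * inner_on ?S f f / ?\<delta>"
    using convolve_norm_bound[OF fin ord A f] \<delta> by (simp add: field_simps)
  also have "\<dots> \<le> ?n * ?m * ?m / ?\<delta>"
    using ff \<delta> by (intro divide_right_mono mult_left_mono) auto
  finally have "(inner_on ?S u (convolve G A f))\<^sup>2 \<le> ?m * (?n * ?m * ?m / ?\<delta>)"
    using inner_on_Cauchy_Schwarz[of ?S u "convolve G A f"] uu
    by (smt (verit) mult_left_mono of_nat_0_le_iff)
  also have "\<dots> = (?m * sqrt (?n * ?m / ?\<delta>))\<^sup>2"
    unfolding power_mult_distrib by (simp add: power2_eq_square[of ?m])
  finally have "\<bar>inner_on ?S u (convolve G A f)\<bar> \<le> \<bar>?m * sqrt (?n * ?m / ?\<delta>)\<bar>"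
    by (simp only: abs_le_square_iff)
  then have "- (?m * sqrt (?n * ?m / ?\<delta>)) \<le> inner_on ?S u (convolve G A f)"
    by (simp add: abs_mult)
  then show ?thesis using N by linarith
qed

lemma card_product_poor_le:
  assumes fin: "finite (carrier G)" and ord: "order G > 1"
    and p: "p \<le> 1 / real (min_nontrivial_dim G) powr (1/3)"
    and poor: "product_poor G p A"
  shows "real (card A) \<le> 2 * real (order G) / real (min_nontrivial_dim G) powr (1/3)"
proof (rule ccontr)
  let ?n = "real (order G)" and ?m = "real (card A)" and ?\<delta> = "real (min_nontrivial_dim G)"
  define t where "t = ?\<delta> powr (1/3)"
  assume "\<not> ?thesis"
  then have big: "?m > 2 * ?n / t" by (simp add: t_def)
  have A: "A \<subseteq> carrier G" using poor by (simp add: product_poor_def)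
  have \<delta>: "?\<delta> > 0"
    using min_nontrivial_dim_group_pos[OF fin ord] by simp
  have t: "t > 0" using \<delta> by (simp add: t_def)
  have t3: "?\<delta> = t ^ 3" using \<delta> by (simp add: t_def powr_power)
  have n: "?n > 0" using ord by simp
  have m: "?m > 0" using big n t by (smt (verit) divide_pos_pos)
  \<comment> \<open>In terms of the ratio \<open>v\<close> of \<open>card A\<close> to the claimed order of magnitude, the bound on the
    number of pairs becomes \<open>v * (v - 1)\<^sup>2 \<le> 1\<close>, which fails beyond \<open>2\<close>.\<close>
  define v where "v = ?m * t / ?n"
  have v: "v > 2" using big n t by (simp add: v_def field_simps)
  have "?m\<^sup>2 * (?m / ?n) - ?m * sqrt (?n * ?m / ?\<delta>) \<le> p * ?m\<^sup>2"
    using product_count_lower_bound[OF fin ord A] poor by (simp add: product_poor_def)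
  also have "\<dots> \<le> (1 / t) * ?m\<^sup>2" using p by (intro mult_right_mono) (auto simp: t_def)
  finally have "?m\<^sup>2 * (?m / ?n) - (1 / t) * ?m\<^sup>2 \<le> ?m * sqrt (?n * ?m / ?\<delta>)" by simp
  moreover have "?m\<^sup>2 * (?m / ?n) - (1 / t) * ?m\<^sup>2 = ?m * (?m / t * (v - 1))"
    using n t by (simp add: v_def field_simps power2_eq_square)
  ultimately have "?m * (?m / t * (v - 1)) \<le> ?m * sqrt (?n * ?m / ?\<delta>)" by linarith
  then have "?m / t * (v - 1) \<le> sqrt (?n * ?m / ?\<delta>)" by (rule mult_left_le_imp_le[OF _ m])
  then have "(?m / t * (v - 1))\<^sup>2 \<le> (sqrt (?n * ?m / ?\<delta>))\<^sup>2"
    using m t v by (intro power_mono) auto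
  also have "\<dots> = ?n * ?m / t ^ 3" using t3 t by simp
  finally have "(?m / t * (v - 1))\<^sup>2 * (t ^ 3 / (?n * ?m)) \<le> ?n * ?m / t ^ 3 * (t ^ 3 / (?n * ?m))"
    using n m t by (intro mult_right_mono) auto
  moreover have "(?m / t * (v - 1))\<^sup>2 * (t ^ 3 / (?n * ?m)) = v * (v - 1)\<^sup>2"
    unfolding v_def using n m t
    by (simp add: power_mult_distrib power2_eq_square power3_eq_cube)
  moreover have "?n * ?m / t ^ 3 * (t ^ 3 / (?n * ?m)) = 1" using n m t by simp
  ultimately have "v * (v - 1)\<^sup>2 \<le> 1" by linarith
  moreover have "(v - 1)\<^sup>2 > 1" using v by (simp add: one_less_power)
  then have "v * (v - 1)\<^sup>2 > 2 * 1" using v by (intro mult_strict_mono) auto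
  ultimately show False by simp
qed

end

theorem corollary8:
  fixes p :: real
  assumes "p \<ge> 0"
  shows "\<exists>c :: real.
    (\<forall>(G :: 'a monoid) A.
       group G \<and> finite (carrier G) \<and> order G > 1 \<and>
       p \<le> 1 / real (min_nontrivial_dim G) powr (1/3) \<and>
       product_poor G p A \<longrightarrow>
       real (card A) \<le> c * real (order G) / real (min_nontrivial_dim G) powr (1/3)) \<and>
    (\<forall>(G :: nat monoid) A.
       group G \<and> finite (carrier G) \<and> order G > 1 \<and>
       p \<le> 1 / real (min_nontrivial_dim G) powr (1/3) \<and>
       product_poor G p A \<longrightarrow>
       real (card A) \<le> c * real (order G) / real (min_nontrivial_dim G) powr (1/3))"
  by (intro exI[of _ 2] conjI allI impI; elim conjE) (rule group.card_product_poor_le; assumption)+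

end
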